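(* For every $n\ge1$, the composite $\Lambda\circ\Phi:\mathrm{SPCT}((2^n))\to\mathrm{LTree}_n$ is a bijection, and for every $\tau\in\mathrm{SPCT}((2^n))$, writing $T=\Lambda(\Phi(\tau))$, $$(|\mathrm{des}_N(\tau)|,|\mathrm{des}_S(\tau)|,|\mathrm{des}_{NE}(\tau)|,|\mathrm{des}_{SE}(\tau)|)=(\mathrm{lasc}(T),\mathrm{ldes}(T),\mathrm{rasc}(T),\mathrm{rdes}(T)).$$
   Context: $\mathrm{SPCT}((2^n))$ is the set of fillings $\tau$ of the $n\times2$ array ($n$ rows of length 2) with the distinct integers $1,\dots,2n$ such that each row decreases left to right and (triple condition) whenever $i<r$ and the entries in cells $(i,1),(i,2),(r,2)$ are $a,b,c$, $a\ge c$ implies $b>c$. For such $\tau$, with $i$ an entry of the first column: $i\in\mathrm{des}_N(\tau)$ if $i+1$ is in the first column in a row above that of $i$; $i\in\mathrm{des}_S(\tau)$ if $i+1$ is in the first column in a row below that of $i$; $i\in\mathrm{des}_{NE}(\tau)$ if $i+1$ is in the second column in a row strictly above that of $i$; $i\in\mathrm{des}_{SE}(\tau)$ if $i+1$ is in the second column in a row strictly below that of $i$. A labeled Dyck path of semi-length $n$ is a Dyck path from $(0,0)$ to $(2n,0)$ (up-steps $(1,1)$, down-steps $(1,-1)$, never below the axis) whose down-steps carry distinct labels from $[n]$; $\mathrm{LDyck}_n$ is their set. Up-steps are labeled as follows: for $i=n,\dots,1$, the $i$-th up-step gets label $\min(\mathfrak{D}_i\setminus\mathfrak{U}_i)$, where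 $\mathfrak{D}_i$ is the set of labels of down-steps after it and $\mathfrak{U}_i$ the set of labels of up-steps after it. $\Phi(\tau)\in\mathrm{LDyck}_n$: for $1\le i\le2n$, the $i$-th step is an up-step if $i$ is in column 2 of $\tau$, otherwise a down-step labeled by the index of the row of $\tau$ containing $i$. A labeled binary tree on $n$ nodes is a rooted plane tree in which each node has at most one left child and at most one right child, with nodes labeled distinctly by $[n]$; $\mathrm{LTree}_n$ is their set. A left path is a binary tree with no right children. An edge from $p$ to its right child $q$ is a right ascent if $\mathrm{label}(p)<\mathrm{label}(q)$ and a right descent otherwise; an edge from $p$ to its left child $q$ is a left ascent if $\mathrm{label}(p)<\mathrm{label}(q)$ and a left descent otherwise. $\mathrm{rasc},\mathrm{rdes},\mathrm{lasc},\mathrm{ldes}$ count these. $\Lambda:\mathrm{LDyck}_n\to\mathrm{LTree}_n$: a run of $D$ is a maximal sequence of consecutive down-steps (with labels). List the runs from right to left as $R_1,\dots,R_m$ ($R_1$ ends at the last step). Each run $R_i$ gives a left path $T_i$ whose node labels from root to leaf are the labels of $R_i$ read right to left. Set $T:=T_1$; for $i=2,\dots,m$, let $j$ be the label of the up-step immediately after the rightmost down-step of $R_i$, and attach $T_i$ as the right subtree of the node labeled $j$ in the current $T$. $\Lambda(D)$ is the final tree. *)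

theory Defs
  imports Main "HOL-Library.FuncSet" "HOL-Library.Tree"
begin

section \<open>Standard permuted composition tableaux of shape $(2^n)$\<close>

text \<open>
  Cells are pairs (row, column), both counted from 1. Rows are drawn from top to bottom, so
  ``above'' means ``smaller row index''. A filling is a function on the cells, taken to be
  \<^const>\<open>extensional\<close> so that two fillings are equal iff they agree on every cell.
\<close>

definition cells :: "nat \<Rightarrow> (nat \<times> nat) set" where
  "cells n = {1..n} \<times> {1, 2}"

definition SPCT :: "nat \<Rightarrow> (nat \<times> nat \<Rightarrow> nat) set" where
  "SPCT n = {\<tau>. \<tau> \<in> extensional (cells n) \<and> bij_betw \<tau> (cells n) {1..2 * n} \<and>
     (\<forall>i\<in>{1..n}. \<tau> (i, 1) > \<tau> (i, 2)) \<and>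
     (\<forall>i\<in>{1..n}. \<forall>r\<in>{1..n}. i < r \<longrightarrow> \<tau> (i, 1) \<ge> \<tau> (r, 2) \<longrightarrow> \<tau> (i, 2) > \<tau> (r, 2))}"

definition des_N :: "nat \<Rightarrow> (nat \<times> nat \<Rightarrow> nat) \<Rightarrow> nat set" where
  "des_N n \<tau> = {i. \<exists>r\<in>{1..n}. \<exists>s\<in>{1..n}. \<tau> (r, 1) = i \<and> \<tau> (s, 1) = i + 1 \<and> s < r}"

definition des_S :: "nat \<Rightarrow> (nat \<times> nat \<Rightarrow> nat) \<Rightarrow> nat set" where
  "des_S n \<tau> = {i. \<exists>r\<in>{1..n}. \<exists>s\<in>{1..n}. \<tau> (r, 1) = i \<and> \<tau> (s, 1) = i + 1 \<and> s > r}"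

definition des_NE :: "nat \<Rightarrow> (nat \<times> nat \<Rightarrow> nat) \<Rightarrow> nat set" where
  "des_NE n \<tau> = {i. \<exists>r\<in>{1..n}. \<exists>s\<in>{1..n}. \<tau> (r, 1) = i \<and> \<tau> (s, 2) = i + 1 \<and> s < r}"

definition des_SE :: "nat \<Rightarrow> (nat \<times> nat \<Rightarrow> nat) \<Rightarrow> nat set" where
  "des_SE n \<tau> = {i. \<exists>r\<in>{1..n}. \<exists>s\<in>{1..n}. \<tau> (r, 1) = i \<and> \<tau> (s, 2) = i + 1 \<and> s > r}"


section \<open>Labeled Dyck paths\<close>

datatype step = is_Up: Up | is_Down: Down (down_label: nat)

definition down_labels :: "step list \<Rightarrow> nat list" where
  "down_labels D = map down_label (filter is_Down D)"

definition path_height :: "step list \<Rightarrow> int" where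
  "path_height D = int (length (filter is_Up D)) - int (length (filter is_Down D))"

definition LDyck :: "nat \<Rightarrow> step list set" where
  "LDyck n = {D. length D = 2 * n \<and> (\<forall>k\<le>2 * n. path_height (take k D) \<ge> 0) \<and> path_height D = 0 \<and>
     distinct (down_labels D) \<and> set (down_labels D) \<subseteq> {1..n}}"

text \<open>
  The labels of the up-steps, from left to right. The label of an up-step depends only on the part
  of the path after it, so the recursion along the list performs the labeling from right to left:
  for an up-step followed by \<open>S\<close>, the sets $\mathfrak{D}_i$ and $\mathfrak{U}_i$ are
  \<open>set (down_labels S)\<close> and \<open>set (up_labels S)\<close>.
\<close>

fun up_labels :: "step list \<Rightarrow> nat list" where
  "up_labels [] = []"
| "up_labels (Down l # S) = up_labels S"
| "up_labels (Up # S) = Min (set (down_labels S) - set (up_labels S)) # up_labels S"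

definition row_of :: "nat \<Rightarrow> (nat \<times> nat \<Rightarrow> nat) \<Rightarrow> nat \<Rightarrow> nat" where
  "row_of n \<tau> k = (THE r. r \<in> {1..n} \<and> (\<tau> (r, 1) = k \<or> \<tau> (r, 2) = k))"

definition Phi :: "nat \<Rightarrow> (nat \<times> nat \<Rightarrow> nat) \<Rightarrow> step list" where
  "Phi n \<tau> = map (\<lambda>k. if \<exists>r\<in>{1..n}. \<tau> (r, 2) = k then Up else Down (row_of n \<tau> k)) [1..<2 * n + 1]"

lemma Phi_in_LDyck:
  assumes "\<tau> \<in> SPCT n"
  shows "Phi n \<tau> \<in> LDyck n"
proof -
  have bij: "bij_betw \<tau> (cells n) {1..2 * n}"
    and row: "\<And>r. r \<in> {1..n} \<Longrightarrow> \<tau> (r, 2) < \<tau> (r, 1)"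
    using assms by (auto simp: SPCT_def)
  have inj: "\<tau> (r, c) = \<tau> (s, d) \<longleftrightarrow> r = s \<and> c = d"
    if "r \<in> {1..n}" "s \<in> {1..n}" "c \<in> {1, 2}" "d \<in> {1, 2}" for r s c d
    using that inj_onD[OF bij_betw_imp_inj_on[OF bij], of "(r, c)" "(s, d)"]
    by (auto simp: cells_def)
  have range: "1 \<le> \<tau> (r, c) \<and> \<tau> (r, c) \<le> 2 * n" if "r \<in> {1..n}" "c \<in> {1, 2}" for r c
    using that bij_betwE[OF bij] by (force simp: cells_def)
  have surj: "\<exists>r\<in>{1..n}. k = \<tau> (r, 1) \<or> k = \<tau> (r, 2)" if "k \<in> {1..2 * n}" for k
  proof -
    from that have "k \<in> \<tau> ` cells n" using bij by (simp add: bij_betw_def)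
    then show ?thesis by (auto simp: cells_def)
  qed
  define up where "up k = (\<exists>r\<in>{1..n}. \<tau> (r, 2) = k)" for k
  define f where "f k = (if up k then Up else Down (row_of n \<tau> k))" for k
  have Phi: "Phi n \<tau> = map f [1..<2 * n + 1]"
    by (simp add: Phi_def f_def up_def fun_eq_iff)
  have f_up: "is_Up (f k) = up k" "is_Down (f k) = (\<not> up k)" for k
    by (simp_all add: f_def)
  have row_of: "row_of n \<tau> (\<tau> (r, 1)) = r" if "r \<in> {1..n}" for r
    unfolding row_of_def by (rule the_equality) (use that inj in auto)
  have not_up: "\<exists>r\<in>{1..n}. k = \<tau> (r, 1)" if "\<not> up k" "k \<in> {1..2 * n}" for k
    using that surj[of k] by (auto simp: up_def)
  have not_up1: "\<not> up (\<tau> (r, 1))" if "r \<in> {1..n}" for r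
    using that inj by (auto simp: up_def)
  have ht: "path_height (take m (Phi n \<tau>)) =
      int (card {r\<in>{1..n}. \<tau> (r, 2) \<le> m}) - int (card {r\<in>{1..n}. \<tau> (r, 1) \<le> m})"
    if m: "m \<le> 2 * n" for m
  proof -
    have take: "take m (Phi n \<tau>) = map f [1..<m + 1]"
      using m by (simp add: Phi take_map take_upt del: upt_Suc)
    have count: "length (filter P (map f [1..<m + 1])) = card {k\<in>{1..m}. P (f k)}" for P
    proof -
      have "length (filter P (map f [1..<m + 1])) = length (filter (P \<circ> f) [1..<m + 1])"
        by (simp add: filter_map del: upt_Suc)
      also have "\<dots> = card (set (filter (P \<circ> f) [1..<m + 1]))"
        by (rule distinct_card[symmetric]) (simp del: upt_Suc)
      also have "set (filter (P \<circ> f) [1..<m + 1]) = {k\<in>{1..m}. P (f k)}"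
        by auto
      finally show ?thesis .
    qed
    have "{k\<in>{1..m}. up k} = (\<lambda>r. \<tau> (r, 2)) ` {r\<in>{1..n}. \<tau> (r, 2) \<le> m}"
      using range by (fastforce simp: up_def)
    then have 1: "card {k\<in>{1..m}. up k} = card {r\<in>{1..n}. \<tau> (r, 2) \<le> m}"
      using inj by (auto intro!: card_image inj_onI)
    have "{k\<in>{1..m}. \<not> up k} = (\<lambda>r. \<tau> (r, 1)) ` {r\<in>{1..n}. \<tau> (r, 1) \<le> m}"
    proof (intro equalityI subsetI)
      fix k assume k: "k \<in> {k\<in>{1..m}. \<not> up k}"
      then obtain r where "r \<in> {1..n}" "k = \<tau> (r, 1)"
        using not_up[of k] m by auto
      with k show "k \<in> (\<lambda>r. \<tau> (r, 1)) ` {r\<in>{1..n}. \<tau> (r, 1) \<le> m}" by auto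
    next
      fix k assume "k \<in> (\<lambda>r. \<tau> (r, 1)) ` {r\<in>{1..n}. \<tau> (r, 1) \<le> m}"
      then obtain r where "r \<in> {1..n}" "k = \<tau> (r, 1)" "\<tau> (r, 1) \<le> m" by auto
      then show "k \<in> {k\<in>{1..m}. \<not> up k}"
        using not_up1[of r] range[of r 1] by auto
    qed
    then have 2: "card {k\<in>{1..m}. \<not> up k} = card {r\<in>{1..n}. \<tau> (r, 1) \<le> m}"
      using inj by (auto intro!: card_image inj_onI)
    show ?thesis
      unfolding path_height_def take count by (simp only: f_up 1 2)
  qed
  have len: "length (Phi n \<tau>) = 2 * n" by (simp add: Phi_def)
  have nonneg: "path_height (take m (Phi n \<tau>)) \<ge> 0" if "m \<le> 2 * n" for m
  proof -
    have "card {r\<in>{1..n}. \<tau> (r, 1) \<le> m} \<le> card {r\<in>{1..n}. \<tau> (r, 2) \<le> m}"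
      using row by (intro card_mono) (auto intro: order.trans[OF less_imp_le])
    then show ?thesis by (simp add: ht[OF that])
  qed
  have zero: "path_height (Phi n \<tau>) = 0"
  proof -
    have "{r\<in>{1..n}. \<tau> (r, 1) \<le> 2 * n} = {1..n}" "{r\<in>{1..n}. \<tau> (r, 2) \<le> 2 * n} = {1..n}"
      using range by auto
    then show ?thesis using ht[of "2 * n"] len by simp
  qed
  define ks where "ks = filter (\<lambda>k. \<not> up k) [1..<2 * n + 1]"
  have ks: "\<exists>r\<in>{1..n}. k = \<tau> (r, 1)" if "k \<in> set ks" for k
    using that not_up[of k] by (auto simp: ks_def simp del: upt_Suc)
  have labels: "down_labels (Phi n \<tau>) = map (row_of n \<tau>) ks"
    unfolding down_labels_def Phi ks_def
    by (simp add: filter_map comp_def f_up f_def del: upt_Suc cong: map_cong)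
  have "inj_on (row_of n \<tau>) (set ks)"
    by (rule inj_onI) (metis ks row_of)
  then have "distinct (down_labels (Phi n \<tau>))"
    by (simp add: labels distinct_map) (simp add: ks_def del: upt_Suc)
  moreover have "set (down_labels (Phi n \<tau>)) \<subseteq> {1..n}"
    using ks row_of by (fastforce simp: labels)
  ultimately show ?thesis
    using len nonneg zero by (simp add: LDyck_def)
qed



section \<open>Labeled binary trees\<close>

text \<open>\<^const>\<open>Leaf\<close> is the absence of a (sub)tree; the nodes are the \<^const>\<open>Node\<close>s only.\<close>

definition LTree :: "nat \<Rightarrow> nat tree set" where
  "LTree n = {T. size T = n \<and> distinct (inorder T) \<and> set_tree T \<subseteq> {1..n}}"

definition root_list :: "'a tree \<Rightarrow> 'a list" where
  "root_list T = (case T of Leaf \<Rightarrow> [] | Node l a r \<Rightarrow> [a])"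

text \<open>Edges are given as pairs (label of the parent, label of the child).\<close>

fun left_edges :: "'a tree \<Rightarrow> ('a \<times> 'a) list" where
  "left_edges Leaf = []"
| "left_edges (Node l a r) = map (Pair a) (root_list l) @ left_edges l @ left_edges r"

fun right_edges :: "'a tree \<Rightarrow> ('a \<times> 'a) list" where
  "right_edges Leaf = []"
| "right_edges (Node l a r) = map (Pair a) (root_list r) @ right_edges l @ right_edges r"

definition lasc :: "nat tree \<Rightarrow> nat" where
  "lasc T = length (filter (\<lambda>(p, q). p < q) (left_edges T))"

definition ldes :: "nat tree \<Rightarrow> nat" where
  "ldes T = length (filter (\<lambda>(p, q). \<not> p < q) (left_edges T))"

definition rasc :: "nat tree \<Rightarrow> nat" where
  "rasc T = length (filter (\<lambda>(p, q). p < q) (right_edges T))"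

definition rdes :: "nat tree \<Rightarrow> nat" where
  "rdes T = length (filter (\<lambda>(p, q). \<not> p < q) (right_edges T))"


section \<open>From labeled Dyck paths to labeled binary trees\<close>

text \<open>
  The runs of a path from left to right. Each run comes as a pair \<open>(R, S)\<close> of its list of labels,
  read left to right, and the remaining part \<open>S\<close> of the path after the run, which is empty or
  starts with an up-step.
\<close>

function runs :: "step list \<Rightarrow> (nat list \<times> step list) list" where
  "runs [] = []"
| "runs (Up # D) = runs D"
| "runs (Down l # D) =
     (l # map down_label (takeWhile is_Down D), dropWhile is_Down D) # runs (dropWhile is_Down D)"
  by pat_completeness auto
termination
  by (relation "measure length") (auto simp: less_Suc_eq_le length_dropWhile_le)

text \<open>The left path with the given node labels from root to leaf.\<close>

fun left_path :: "'a list \<Rightarrow> 'a tree" where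
  "left_path [] = Leaf"
| "left_path (a # as) = Node (left_path as) a Leaf"

text \<open>\<open>attach j T' T\<close> makes \<open>T'\<close> the right subtree of the node of \<open>T\<close> labeled \<open>j\<close>.\<close>

fun attach :: "'a \<Rightarrow> 'a tree \<Rightarrow> 'a tree \<Rightarrow> 'a tree" where
  "attach j T' Leaf = Leaf"
| "attach j T' (Node l a r) =
     (if a = j then Node l a T' else Node (attach j T' l) a (attach j T' r))"

text \<open>
  For a run \<open>(R, S)\<close> other than the rightmost one, \<open>hd (up_labels S)\<close> is the label of the up-step
  immediately after the run.
\<close>

definition Lambda :: "step list \<Rightarrow> nat tree" where
  "Lambda D = (case rev (runs D) of
       [] \<Rightarrow> Leaf
     | (R1, _) # Rs \<Rightarrow>
         foldl (\<lambda>T (R, S). attach (hd (up_labels S)) (left_path (rev R)) T) (left_path (rev R1)) Rs)"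

end

(*
  For a tableau \<tau>, the tree of \<tau> has a left (right) edge from s to r exactly when the entry after
  \<tau> (r, 1) is \<tau> (s, 1) (respectively \<tau> (s, 2)), and its root is the row of 2n. The equality of the
  statistics is read off from this.

  The triple condition says that the row of a second-column entry k is the least row r with
  \<tau> (r, 2) \<le> k < \<tau> (r, 1). Hence the cells of 2n, 2n - 1, ... can be recovered one after the other
  from the tree: the edge leaving the current cell, if any, gives the next cell in the first column,
  and otherwise the next cell is in the second column, in the least open row. This gives
  injectivity. For surjectivity the same procedure is run on an arbitrary tree. When it cannot be
  continued, the visited nodes contain the root and are closed under children, so a tableau has been
  built; the edges of its tree are edges of the given one, and the two trees have the same root and
  the same size, so they are equal.
*)
theory Submission
  imports Defs "HOL-Library.Multiset"
begin

section \<open>Edges of binary trees\<close>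

text \<open>Every node occurrence is either the root or the child end of exactly one edge. With
  multisets this holds for repeated labels too, so the induction carries no distinctness
  hypothesis.\<close>

lemma mset_inorder_edges:
  "mset (inorder T) =
     mset (root_list T) + mset (map snd (left_edges T)) + mset (map snd (right_edges T))"
  by (induction T) (auto simp: root_list_def comp_def split: tree.splits)

lemma root_list_subset: "set (root_list T) \<subseteq> set_tree T"
  by (cases T) (auto simp: root_list_def)

lemma left_edges_subset: "set (left_edges T) \<subseteq> set_tree T \<times> set_tree T"
  by (induction T) (auto dest: subsetD[OF root_list_subset])

lemma right_edges_subset: "set (right_edges T) \<subseteq> set_tree T \<times> set_tree T"
  by (induction T) (auto dest: subsetD[OF root_list_subset])

lemma distinct_edges:
  assumes "distinct (inorder T)"
  shows "distinct (root_list T @ map snd (left_edges T) @ map snd (right_edges T))"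
proof -
  have "mset (root_list T @ map snd (left_edges T) @ map snd (right_edges T)) = mset (inorder T)"
    by (simp add: mset_inorder_edges)
  from mset_eq_imp_distinct_iff[OF this] assms show ?thesis by simp
qed

lemma distinct_fst_edges:
  "distinct (inorder T) \<Longrightarrow>
     distinct (map fst (left_edges T)) \<and> distinct (map fst (right_edges T))"
proof (induction T)
  case (Node l a r)
  have sub: "fst ` set (left_edges t) \<subseteq> set_tree t" "fst ` set (right_edges t) \<subseteq> set_tree t"
    for t :: "'a tree"
    using left_edges_subset[of t] right_edges_subset[of t] by auto
  have root: "distinct (map fst (map (Pair a) (root_list t)))"
    "fst ` Pair a ` set (root_list t) \<subseteq> {a}" for t :: "'a tree"
    by (auto simp: root_list_def split: tree.splits)
  have disj: "set_tree l \<inter> set_tree r = {}" "a \<notin> set_tree l" "a \<notin> set_tree r"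
    and dist: "distinct (inorder l)" "distinct (inorder r)"
    using Node.prems by auto
  have disti: "distinct (map fst (map (Pair a) (root_list t) @ xs @ ys))"
    if "distinct (map fst xs)" "distinct (map fst ys)"
      "fst ` set xs \<subseteq> set_tree l" "fst ` set ys \<subseteq> set_tree r"
    for xs ys and t :: "'a tree"
  proof -
    have "fst ` set xs \<inter> fst ` set ys = {}" "a \<notin> fst ` set xs" "a \<notin> fst ` set ys"
      using that(3,4) disj by blast+
    then show ?thesis using that(1,2) root[of t] by auto
  qed
  show ?case
    unfolding left_edges.simps right_edges.simps
    using Node.IH(1)[OF dist(1)] Node.IH(2)[OF dist(2)] sub[of l] sub[of r]
    by (intro conjI disti) auto
qed simp

text \<open>The argument \<open>c\<close> is a column of the tableau: column 1 corresponds to the edges to left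
  children, column 2 to the edges to right children.\<close>

definition edges :: "'a tree \<Rightarrow> nat \<Rightarrow> ('a \<times> 'a) set" where
  "edges T c = (if c = 1 then set (left_edges T) else set (right_edges T))"

lemma edges_subset: "edges T c \<subseteq> set_tree T \<times> set_tree T"
  using left_edges_subset[of T] right_edges_subset[of T] by (simp add: edges_def)

lemma edges_unique_parent:
  assumes "distinct (inorder T)" "(p, q) \<in> edges T c" "(p', q) \<in> edges T c'"
    "c \<in> {1, 2}" "c' \<in> {1, 2}"
  shows "p = p'" "c = c'"
proof -
  have d: "distinct (map snd (left_edges T))" "distinct (map snd (right_edges T))"
    "snd ` set (left_edges T) \<inter> snd ` set (right_edges T) = {}"
    using distinct_edges[OF assms(1)] by auto
  have "\<not> ((x, q) \<in> set (left_edges T) \<and> (y, q) \<in> set (right_edges T))" for x y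
    using d(3) by (metis disjoint_iff image_eqI snd_conv)
  then show "c = c'" using assms(2-5) by (auto simp: edges_def)
  then show "p = p'"
    using assms(2-5) d(1,2) inj_onD[of snd _ "(p, q)" "(p', q)"]
    unfolding edges_def distinct_map by (metis prod.inject snd_conv)
qed

lemma edges_unique_child:
  assumes "distinct (inorder T)" "(p, q) \<in> edges T c" "(p, q') \<in> edges T c"
  shows "q = q'"
  using assms distinct_fst_edges[OF assms(1)] inj_onD[of fst _ "(p, q)" "(p, q')"]
  unfolding edges_def distinct_map by (metis prod.inject fst_conv)

lemma root_no_parent:
  assumes "distinct (inorder T)" "a \<in> set (root_list T)"
  shows "(p, a) \<notin> edges T c"
proof -
  have "a \<notin> snd ` set (left_edges T)" "a \<notin> snd ` set (right_edges T)"
    using distinct_edges[OF assms(1)] assms(2) by auto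
  then show ?thesis by (auto simp: edges_def image_iff split: if_splits)
qed

text \<open>Every node is reached from the root along edges. This later shows that a stuck traversal
  has visited the whole tree.\<close>

lemma set_tree_subset_closed:
  assumes "set (root_list T) \<subseteq> N"
    and "\<And>p q. p \<in> N \<Longrightarrow> (p, q) \<in> set (left_edges T) \<union> set (right_edges T) \<Longrightarrow> q \<in> N"
  shows "set_tree T \<subseteq> N"
  using assms
proof (induction T)
  case (Node l a r)
  have a: "a \<in> N" using Node.prems(1) by (simp add: root_list_def)
  have "set (root_list l) \<subseteq> N" "set (root_list r) \<subseteq> N"
    using Node.prems(2)[OF a] by auto
  moreover have "q \<in> N" if "p \<in> N"
    "(p, q) \<in> set (left_edges l) \<union> set (right_edges l) \<or>
     (p, q) \<in> set (left_edges r) \<union> set (right_edges r)" for p q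
    using that by (intro Node.prems(2)[of p q]) auto
  ultimately have "set_tree l \<subseteq> N" "set_tree r \<subseteq> N"
    using Node.IH by blast+
  with a show ?case by simp
qed simp

section \<open>Comparing trees through their edges\<close>

text \<open>Meant for a tree with root \<open>a\<close> and subtrees on the node sets
  \<open>X\<close> and \<open>Y\<close>: the source of an edge tells whether it leaves the root or
  lies in the left or in the right subtree.\<close>

lemma relation_split:
  assumes eq: "A \<union> B \<union> C = E \<inter> insert a (X \<union> Y) \<times> UNIV"
    and sub: "A \<subseteq> {a} \<times> UNIV" "B \<subseteq> X \<times> UNIV" "C \<subseteq> Y \<times> UNIV"
    and disj: "X \<inter> Y = {}" "a \<notin> X" "a \<notin> Y"
  shows "A = E \<inter> {a} \<times> UNIV" "B = E \<inter> X \<times> UNIV" "C = E \<inter> Y \<times> UNIV"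
proof -
  have AB: "E \<inter> {a} \<times> UNIV = (A \<union> B \<union> C) \<inter> {a} \<times> UNIV"
    "E \<inter> X \<times> UNIV = (A \<union> B \<union> C) \<inter> X \<times> UNIV"
    "E \<inter> Y \<times> UNIV = (A \<union> B \<union> C) \<inter> Y \<times> UNIV"
    unfolding eq by auto
  show "A = E \<inter> {a} \<times> UNIV" unfolding AB using sub disj by blast
  show "B = E \<inter> X \<times> UNIV" unfolding AB using sub disj by blast
  show "C = E \<inter> Y \<times> UNIV" unfolding AB using sub disj by blast
qed

text \<open>\<open>E\<close> and \<open>F\<close> stay fixed in the induction, as edges of an
  ambient tree, while \<open>T\<close> descends to subtrees that are full below their roots. Going
  down from the common root, \<open>T'\<close> can differ from \<open>T\<close> only by missing
  subtrees, and each missing subtree costs size.\<close>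

lemma restricted_tree_size:
  assumes "distinct (inorder T)"
    and "set (left_edges T) = E \<inter> set_tree T \<times> UNIV"
    and "set (right_edges T) = F \<inter> set_tree T \<times> UNIV"
    and "set (left_edges T') \<subseteq> E" "set (right_edges T') \<subseteq> F"
    and "root_list T' = root_list T"
  shows "size T' \<le> size T \<and> (size T' = size T \<longrightarrow> T' = T)"
  using assms
proof (induction T' arbitrary: T)
  case Leaf
  then show ?case by (cases T) (auto simp: root_list_def)
next
  case (Node l' a r')
  then obtain l r where T: "T = Node l a r"
    by (cases T) (auto simp: root_list_def)
  have disj: "set_tree l \<inter> set_tree r = {}" "a \<notin> set_tree l" "a \<notin> set_tree r"
    and dist: "distinct (inorder l)" "distinct (inorder r)"
    using Node.prems(1) by (auto simp: T)
  have L: "Pair a ` set (root_list l) \<union> set (left_edges l) \<union> set (left_edges r) =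
      E \<inter> insert a (set_tree l \<union> set_tree r) \<times> UNIV"
    using Node.prems(2) by (simp add: T Un_assoc)
  have R: "Pair a ` set (root_list r) \<union> set (right_edges l) \<union> set (right_edges r) =
      F \<inter> insert a (set_tree l \<union> set_tree r) \<times> UNIV"
    using Node.prems(3) by (simp add: T Un_assoc)
  have sub: "set (left_edges t) \<subseteq> set_tree t \<times> UNIV" "set (right_edges t) \<subseteq> set_tree t \<times> UNIV"
    "Pair a ` set (root_list t) \<subseteq> {a} \<times> UNIV" for t
    by (rule order_trans[OF left_edges_subset], blast)
      (rule order_trans[OF right_edges_subset], blast, blast)
  note L' = relation_split[OF L sub(3) sub(1) sub(1) disj]
  note R' = relation_split[OF R sub(3) sub(2) sub(2) disj]
  have rootl: "x \<in> set (root_list l)" if "(a, x) \<in> E" for x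
  proof -
    have "(a, x) \<in> Pair a ` set (root_list l)" unfolding L'(1) using that by simp
    then show ?thesis by auto
  qed
  have rootr: "x \<in> set (root_list r)" if "(a, x) \<in> F" for x
  proof -
    have "(a, x) \<in> Pair a ` set (root_list r)" unfolding R'(1) using that by simp
    then show ?thesis by auto
  qed
  \<comment> \<open>A root list has at most one element, so inclusion means that \<open>t'\<close>
    is empty or has the same root.\<close>
  have root_eq: "t' = Leaf \<or> root_list t' = root_list t"
    if "set (root_list t') \<subseteq> set (root_list t)" for t t' :: "'a tree"
    using that by (cases t; cases t') (auto simp: root_list_def)
  have "l' = Leaf \<or> root_list l' = root_list l"
    using Node.prems(4) rootl by (intro root_eq) auto
  then have 1: "size l' \<le> size l \<and> (size l' = size l \<longrightarrow> l' = l)"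
  proof
    assume "root_list l' = root_list l"
    then show ?thesis
      using Node.prems(4,5) by (intro Node.IH(1)[OF dist(1) L'(2) R'(2)]) auto
  qed auto
  have "r' = Leaf \<or> root_list r' = root_list r"
    using Node.prems(5) rootr by (intro root_eq) auto
  then have 2: "size r' \<le> size r \<and> (size r' = size r \<longrightarrow> r' = r)"
  proof
    assume "root_list r' = root_list r"
    then show ?thesis
      using Node.prems(4,5) by (intro Node.IH(2)[OF dist(2) L'(3) R'(3)]) auto
  qed auto
  from 1 2 show ?case by (auto simp: T)
qed

lemma tree_eq_if_edges_subset:
  assumes "distinct (inorder T)" "root_list T' = root_list T" "size T' = size T"
    and "edges T' 1 \<subseteq> edges T 1" "edges T' 2 \<subseteq> edges T 2"
  shows "T' = T"
proof -
  have "set (left_edges T) = set (left_edges T) \<inter> set_tree T \<times> UNIV"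
    "set (right_edges T) = set (right_edges T) \<inter> set_tree T \<times> UNIV"
    using left_edges_subset[of T] right_edges_subset[of T] by auto
  from restricted_tree_size[OF assms(1) this, of T'] show ?thesis
    using assms(2-) by (simp add: edges_def)
qed

section \<open>Grafting a right subtree\<close>

lemma attach_idle: "j \<notin> set_tree T \<Longrightarrow> attach j T' T = T"
  by (induction T) auto

lemma root_list_attach: "root_list (attach j T' T) = root_list T"
  by (cases T) (auto simp: root_list_def)

text \<open>Distinct labels confine the change to one place. Since \<open>attach\<close> overwrites
  the right subtree of \<open>j\<close>, that subtree has to be empty for nothing to be lost; this
  is the third hypothesis.\<close>

lemma attach_props:
  assumes "distinct (inorder T)" "j \<in> set_tree T" "j \<notin> fst ` set (right_edges T)"
  shows "mset (inorder (attach j T' T)) = mset (inorder T) + mset (inorder T') \<and>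
    set (left_edges (attach j T' T)) = set (left_edges T) \<union> set (left_edges T') \<and>
    set (right_edges (attach j T' T)) =
      Pair j ` set (root_list T') \<union> set (right_edges T) \<union> set (right_edges T')"
  using assms
proof (induction T)
  case (Node l a r)
  show ?case
  proof (cases "a = j")
    case True
    then have "r = Leaf" using Node.prems(3) by (cases r) (auto simp: root_list_def)
    then show ?thesis using True by (auto simp: root_list_def)
  next
    case False
    have nl: "j \<notin> fst ` set (right_edges l)" and nr: "j \<notin> fst ` set (right_edges r)"
      using Node.prems(3) by auto
    show ?thesis
    proof (cases "j \<in> set_tree l")
      case True
      then have "j \<notin> set_tree r" using Node.prems(1) by auto
      then show ?thesis
        using Node.IH(1)[OF _ True nl] Node.prems(1) False
        by (auto simp: attach_idle root_list_attach)
    next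
      case left: False
      then have "j \<in> set_tree r" using Node.prems(2) False by auto
      then show ?thesis
        using Node.IH(2)[OF _ _ nr] Node.prems(1) False left
        by (auto simp: attach_idle root_list_attach)
    qed
  qed
qed simp


section \<open>Edges of the tree of a labeled path\<close>

text \<open>Inherited by suffixes, hence fit for induction from the right. The nonemptiness
  condition makes the \<open>Min\<close> that labels an up-step an element of its set.\<close>

fun valid :: "step list \<Rightarrow> bool" where
  "valid [] = True"
| "valid (Down l # S) = (l \<notin> set (down_labels S) \<and> valid S)"
| "valid (Up # S) = (set (down_labels S) - set (up_labels S) \<noteq> {} \<and> valid S)"

text \<open>Intended as the left edges of \<open>Lambda\<close>, parent first. A run is read from
  right to left, so of two adjacent down-steps the later one is the parent.\<close>

fun left_pairs :: "step list \<Rightarrow> (nat \<times> nat) set" where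
  "left_pairs (Down k # Down l # S) = insert (l, k) (left_pairs (Down l # S))"
| "left_pairs (s # S) = left_pairs S"
| "left_pairs [] = {}"

text \<open>Intended as the right edges of \<open>Lambda\<close>: the last down-step of a run is the
  root of its left path, which is attached at the label of the up-step that follows.\<close>

fun right_pairs :: "step list \<Rightarrow> (nat \<times> nat) set" where
  "right_pairs (Down k # Up # S) = insert (hd (up_labels (Up # S)), k) (right_pairs (Up # S))"
| "right_pairs (s # S) = right_pairs S"
| "right_pairs [] = {}"

lemma down_labels_simps [simp]:
  "down_labels [] = []"
  "down_labels (Down l # S) = l # down_labels S"
  "down_labels (Up # S) = down_labels S"
  "down_labels (map Down R @ S) = R @ down_labels S"
  by (simp_all add: down_labels_def filter_map comp_def)

lemma pairs_Up [simp]: "left_pairs (Up # S) = left_pairs S" "right_pairs (Up # S) = right_pairs S"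
  by (cases S; simp)+

text \<open>Ensures that a label not yet taken by an up-step belongs to a node whose right child is
  still missing.\<close>

lemma fst_right_pairs: "fst ` right_pairs S \<subseteq> set (up_labels S)"
proof (induction S)
  case (Cons s S)
  show ?case
  proof (cases s)
    case (Down k)
    then show ?thesis
    proof (cases S)
      case (Cons t S')
      then show ?thesis using \<open>s = Down k\<close> Cons.IH by (cases t) auto
    qed simp
  qed (use Cons.IH in auto)
qed simp

lemma valid_append: "valid (P @ S) \<Longrightarrow> valid S"
  by (induction P rule: valid.induct) auto

lemma valid_distinct: "valid S \<Longrightarrow> distinct (down_labels S)"
  by (induction S rule: valid.induct) auto

text \<open>Induction adapted to \<open>Lambda\<close>: a whole run is put in front of the path
  together with the up-step after it, which is one attachment.\<close>

lemma path_run_induct [case_names Nil Up run run_Up]: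
  assumes "P []" "\<And>S. P S \<Longrightarrow> P (Up # S)" "\<And>R. R \<noteq> [] \<Longrightarrow> P (map Down R)"
    and "\<And>R S. R \<noteq> [] \<Longrightarrow> P S \<Longrightarrow> P (map Down R @ Up # S)"
  shows "P S"
proof -
  \<comment> \<open>\<open>R\<close> accumulates the down-steps of the run being read, until an
    up-step or the end of the path completes it.\<close>
  have "P (map Down R @ S)" for R
  proof (induction S arbitrary: R)
    case Nil
    then show ?case using assms(1,3) by (cases "R = []") auto
  next
    case (Cons s S)
    show ?case
    proof (cases s)
      case Up
      then show ?thesis using assms(2,4) Cons[of "[]"] by (cases "R = []") auto
    next
      case (Down l)
      then show ?thesis using Cons[of "R @ [l]"] by simp
    qed
  qed
  from this[of "[]"] show ?thesis by simp
qed

section \<open>The recursion of \<open>Lambda\<close> over runs\<close>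

lemma runs_run: "R \<noteq> [] \<Longrightarrow> runs (map Down R) = [(R, [])]"
proof (cases R)
  case (Cons l R')
  have "dropWhile (\<lambda>_. True) R' = []" "takeWhile (\<lambda>_. True) R' = R'"
    by (induction R') auto
  with Cons show ?thesis by (simp add: takeWhile_map dropWhile_map comp_def del: dropWhile_eq_Nil_conv)
qed simp

lemma runs_run_Up: "R \<noteq> [] \<Longrightarrow> runs (map Down R @ Up # S) = (R, Up # S) # runs S"
proof (cases R)
  case (Cons l R')
  have "takeWhile is_Down (map Down R' @ Up # S) = map Down R'"
    "dropWhile is_Down (map Down R' @ Up # S) = Up # S"
    by (subst takeWhile_append2 dropWhile_append2; auto)+
  then show ?thesis by (simp add: Cons comp_def)
qed simp

lemma runs_eq_Nil_iff: "runs S = [] \<longleftrightarrow> down_labels S = []"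
  by (induction S rule: runs.induct) auto

lemma Lambda_Nil: "Lambda [] = Leaf"
  by (simp add: Lambda_def)

lemma Lambda_Up: "Lambda (Up # S) = Lambda S"
  by (simp add: Lambda_def)

lemma Lambda_run: "R \<noteq> [] \<Longrightarrow> Lambda (map Down R) = left_path (rev R)"
  by (simp add: Lambda_def runs_run)

text \<open>The leftmost run is processed last, so it is the final step of the fold. The condition
  on \<open>S\<close> provides a run further right that starts the fold.\<close>

lemma Lambda_run_Up:
  assumes "R \<noteq> []" "down_labels S \<noteq> []"
  shows "Lambda (map Down R @ Up # S) =
    attach (hd (up_labels (Up # S))) (left_path (rev R)) (Lambda S)"
proof -
  have "rev (runs S) \<noteq> []" using assms(2) by (simp add: runs_eq_Nil_iff)
  then show ?thesis
    unfolding Lambda_def runs_run_Up[OF assms(1)]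
    by (cases "rev (runs S)") (auto split: prod.splits)
qed

lemma root_list_left_path: "R \<noteq> [] \<Longrightarrow> root_list (left_path (rev R)) = [last R]"
  by (induction R rule: rev_induct) (auto simp: root_list_def)

lemma inorder_left_path: "inorder (left_path xs) = rev xs"
  by (induction xs) auto

lemma right_edges_left_path: "right_edges (left_path xs) = []"
  by (induction xs) (auto simp: root_list_def)

lemma left_edges_left_path_snoc:
  "set (left_edges (left_path (xs @ [l]))) =
     set (left_edges (left_path xs)) \<union> (if xs = [] then {} else {(last xs, l)})"
proof (induction xs)
  case (Cons x xs)
  then show ?case by (cases xs) (auto simp: root_list_def)
qed (simp add: root_list_def)

text \<open>The hypothesis says that the run ends with \<open>R\<close>, so no pair straddles the
  boundary to \<open>S\<close>. A new first down-step becomes the new deepest node of the left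
  path.\<close>

lemma left_pairs_run:
  assumes "S = [] \<or> hd S = Up"
  shows "left_pairs (map Down R @ S) = set (left_edges (left_path (rev R))) \<union> left_pairs S"
proof (induction R)
  case (Cons l R)
  show ?case
  proof (cases R)
    case Nil
    then show ?thesis using assms by (cases S) (auto simp: root_list_def)
  next
    case (Cons m R')
    have "left_edges (left_path (rev (l # R))) = left_edges (left_path (rev R @ [l]))"
      by simp
    moreover have "left_pairs (map Down (l # R) @ S) = insert (m, l) (left_pairs (map Down R @ S))"
      by (simp add: Cons)
    ultimately show ?thesis
      using Cons.IH by (simp only: left_edges_left_path_snoc) (simp add: Cons)
  qed
qed simp

lemma right_pairs_run: "right_pairs (map Down R) = {}"
proof (induction R)
  case (Cons l R)
  then show ?case by (cases R) auto
qed simp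

lemma right_pairs_run_Up:
  "R \<noteq> [] \<Longrightarrow> right_pairs (map Down R @ Up # S) =
     insert (hd (up_labels (Up # S)), last R) (right_pairs S)"
proof (induction R)
  case (Cons l R)
  then show ?case by (cases R) auto
qed simp

text \<open>Describes the tree by data that can be read off the path locally. By induction on runs,
  each attachment adds the left path and one right edge from \<open>j\<close> to the root of that
  path.\<close>

lemma Lambda_props:
  assumes "valid S"
  shows "mset (inorder (Lambda S)) = mset (down_labels S) \<and>
    root_list (Lambda S) = (if down_labels S = [] then [] else [last (down_labels S)]) \<and>
    set (left_edges (Lambda S)) = left_pairs S \<and>
    set (right_edges (Lambda S)) = right_pairs S"
  using assms
proof (induction S rule: path_run_induct)
  case Nil
  then show ?case by (simp add: Lambda_Nil root_list_def)
next
  case (Up S)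
  then show ?case by (simp add: Lambda_Up)
next
  case (run R)
  have "down_labels (map Down R) = R" using down_labels_simps(4)[of R "[]"] by simp
  then show ?case
    using run left_pairs_run[of "[]" R]
    by (simp add: Lambda_run root_list_left_path inorder_left_path right_edges_left_path
        right_pairs_run)
next
  case (run_Up R S)
  let ?A = "set (down_labels S) - set (up_labels S)"
  define j where "j = hd (up_labels (Up # S))"
  have v: "valid S" and A: "?A \<noteq> {}"
    using valid_append[OF run_Up.prems] by auto
  have "j \<in> ?A" unfolding j_def using Min_in[OF _ A] by simp
  then have j: "j \<in> set (down_labels S)" "j \<notin> set (up_labels S)" by auto
  note IH = run_Up.IH[OF v]
  have ne: "down_labels S \<noteq> []" using j(1) by auto
  have L: "Lambda (map Down R @ Up # S) = attach j (left_path (rev R)) (Lambda S)"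
    unfolding j_def by (rule Lambda_run_Up[OF run_Up.hyps ne])
  have "distinct (inorder (Lambda S))"
    using valid_distinct[OF v] IH mset_eq_imp_distinct_iff by blast
  moreover have "j \<in> set_tree (Lambda S)"
    using j(1) IH by (metis set_inorder set_mset_mset)
  moreover have "j \<notin> fst ` set (right_edges (Lambda S))"
    using j(2) IH fst_right_pairs[of S] by auto
  ultimately have "mset (inorder (Lambda (map Down R @ Up # S))) =
        mset (inorder (Lambda S)) + mset R \<and>
      set (left_edges (Lambda (map Down R @ Up # S))) =
        left_pairs S \<union> set (left_edges (left_path (rev R))) \<and>
      set (right_edges (Lambda (map Down R @ Up # S))) = insert (j, last R) (right_pairs S)"
    using attach_props[of "Lambda S" j "left_path (rev R)"] IH run_Up.hyps
    by (simp add: L inorder_left_path root_list_left_path right_edges_left_path)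
  moreover have "root_list (Lambda (map Down R @ Up # S)) = [last (down_labels S)]"
    using IH ne by (simp add: L root_list_attach)
  ultimately show ?case
    using ne IH left_pairs_run[of "Up # S" R] right_pairs_run_Up[OF run_Up.hyps, of S]
    by (simp add: j_def Un_commute)
qed


section \<open>Edges of the tree of a tableau\<close>

definition time_edges :: "nat \<Rightarrow> (nat \<times> nat \<Rightarrow> nat) \<Rightarrow> nat \<Rightarrow> (nat \<times> nat) set" where
  "time_edges n \<tau> c = {(s, r). s \<in> {1..n} \<and> r \<in> {1..n} \<and> \<tau> (s, c) = Suc (\<tau> (r, 1))}"

text \<open>The path from step \<open>k\<close> on. Up-step labels depend only on later steps, so
  the path is analyzed by descending induction on \<open>k\<close>.\<close>

definition Phi_suffix :: "nat \<Rightarrow> (nat \<times> nat \<Rightarrow> nat) \<Rightarrow> nat \<Rightarrow> step list" where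
  "Phi_suffix n \<tau> k =
     map (\<lambda>k. if \<exists>r\<in>{1..n}. \<tau> (r, 2) = k then Up else Down (row_of n \<tau> k)) [k..<2 * n + 1]"

context
  fixes n :: nat and \<tau> :: "nat \<times> nat \<Rightarrow> nat"
  assumes \<tau>: "\<tau> \<in> SPCT n"
begin

section \<open>Basic properties of a tableau\<close>

lemma SPCT_bij: "bij_betw \<tau> (cells n) {1..2 * n}"
  using \<tau> by (simp add: SPCT_def)

lemma SPCT_row: "r \<in> {1..n} \<Longrightarrow> \<tau> (r, 2) < \<tau> (r, 1)"
  using \<tau> by (simp add: SPCT_def)

lemma SPCT_inj:
  assumes "r \<in> {1..n}" "s \<in> {1..n}" "c \<in> {1, 2}" "d \<in> {1, 2}" "\<tau> (r, c) = \<tau> (s, d)"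
  shows "r = s \<and> c = d"
  using assms inj_onD[OF bij_betw_imp_inj_on[OF SPCT_bij], of "(r, c)" "(s, d)"]
  by (auto simp: cells_def)

lemma SPCT_range:
  assumes "r \<in> {1..n}" "c \<in> {1, 2}"
  shows "\<tau> (r, c) \<in> {1..2 * n}"
  using assms bij_betwE[OF SPCT_bij] by (auto simp: cells_def)

lemma SPCT_surj:
  assumes "k \<in> {1..2 * n}"
  obtains r c where "r \<in> {1..n}" "c \<in> {1, 2}" "\<tau> (r, c) = k"
proof -
  have "k \<in> \<tau> ` cells n" using SPCT_bij assms by (simp add: bij_betw_def)
  then show thesis using that unfolding cells_def by blast
qed

text \<open>Contrapositive of the triple condition: a row \<open>i\<close> above \<open>r\<close>
  cannot be open at the entry \<open>\<tau> (r, 2)\<close>.\<close>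

lemma SPCT_Min:
  assumes "r \<in> {1..n}" "i \<in> {1..n}" "\<tau> (i, 2) \<le> \<tau> (r, 2)" "\<tau> (r, 2) < \<tau> (i, 1)"
  shows "r \<le> i"
proof (rule ccontr)
  assume "\<not> r \<le> i"
  then have "\<tau> (i, 2) > \<tau> (r, 2)" using \<tau> assms by (auto simp: SPCT_def)
  with assms(3) show False by simp
qed

section \<open>The path of a tableau, read from its end\<close>

lemma Phi_suffix_end: "Phi_suffix n \<tau> (2 * n + 1) = []"
  by (simp add: Phi_suffix_def)

lemma Phi_suffix_1: "Phi_suffix n \<tau> 1 = Phi n \<tau>"
  by (simp add: Phi_suffix_def Phi_def)

lemma Phi_suffix_up:
  assumes "r \<in> {1..n}" "\<tau> (r, 2) = k"
  shows "Phi_suffix n \<tau> k = Up # Phi_suffix n \<tau> (Suc k)"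
proof -
  have "k < 2 * n + 1" using SPCT_range[of r 2] assms by auto
  then show ?thesis
    using assms unfolding Phi_suffix_def by (subst upt_conv_Cons) auto
qed

lemma Phi_suffix_down:
  assumes r: "r \<in> {1..n}" "\<tau> (r, 1) = k"
  shows "Phi_suffix n \<tau> k = Down r # Phi_suffix n \<tau> (Suc k)"
proof -
  have k: "k < 2 * n + 1" using SPCT_range[of r 1] assms by auto
  have no_up: "\<tau> (s, 2) \<noteq> k" if "s \<in> {1..n}" for s using SPCT_inj[of s r 2 1] that r by auto
  then have "\<not> (\<exists>s\<in>{1..n}. \<tau> (s, 2) = k)" by blast
  moreover have "row_of n \<tau> k = r"
    unfolding row_of_def
  proof (rule the_equality)
    fix s assume s: "s \<in> {1..n} \<and> (\<tau> (s, 1) = k \<or> \<tau> (s, 2) = k)"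
    then have "\<tau> (s, 1) = k" using no_up by metis
    then show "s = r" using SPCT_inj[of s r 1 1] s r by simp
  qed (use r in simp)
  ultimately show ?thesis
    using k unfolding Phi_suffix_def by (subst upt_conv_Cons) auto
qed

text \<open>The edges already visible in the suffix from step \<open>k\<close> on: the parent's
  entry is one more than the child's, so only the child's entry needs a bound.\<close>

definition late_edges :: "nat \<Rightarrow> nat \<Rightarrow> (nat \<times> nat) set" where
  "late_edges c k = {(s, r). (s, r) \<in> time_edges n \<tau> c \<and> k \<le> \<tau> (r, 1)}"

lemma late_edges_up:
  assumes "r \<in> {1..n}" "\<tau> (r, 2) = k"
  shows "late_edges c k = late_edges c (Suc k)"
proof -
  have "\<tau> (r', 1) \<noteq> k" if "r' \<in> {1..n}" for r'
    using SPCT_inj[of r' r 1 2] that assms by auto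
  then show ?thesis
    by (auto simp: late_edges_def time_edges_def Suc_le_eq le_less)
qed

lemma late_edges_down:
  assumes "r \<in> {1..n}" "\<tau> (r, 1) = k"
  shows "late_edges c k = late_edges c (Suc k) \<union> {(s, r) | s. s \<in> {1..n} \<and> \<tau> (s, c) = Suc k}"
proof -
  have *: "k \<le> \<tau> (r', 1) \<longleftrightarrow> Suc k \<le> \<tau> (r', 1) \<or> r' = r" if "r' \<in> {1..n}" for r'
    using SPCT_inj[of r' r 1 1] that assms by (auto simp: Suc_le_eq le_less)
  have "(s, r') \<in> late_edges c k \<longleftrightarrow>
      (s, r') \<in> late_edges c (Suc k) \<or> r' = r \<and> s \<in> {1..n} \<and> \<tau> (s, c) = Suc k" for s r'
    using assms * by (auto simp: late_edges_def time_edges_def)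
  then show ?thesis by auto
qed

lemma Phi_suffix_props:
  assumes "k \<le> 2 * n + 1" "1 \<le> k"
  shows "valid (Phi_suffix n \<tau> k) \<and>
    set (down_labels (Phi_suffix n \<tau> k)) = {r\<in>{1..n}. k \<le> \<tau> (r, 1)} \<and>
    set (up_labels (Phi_suffix n \<tau> k)) = {r\<in>{1..n}. k \<le> \<tau> (r, 2)} \<and>
    (\<forall>r\<in>{1..n}. \<tau> (r, 2) = k \<longrightarrow> hd (up_labels (Phi_suffix n \<tau> k)) = r) \<and>
    (\<forall>r\<in>{1..n}. k \<le> 2 * n \<and> \<tau> (r, 1) = 2 * n \<longrightarrow> last (down_labels (Phi_suffix n \<tau> k)) = r) \<and>
    left_pairs (Phi_suffix n \<tau> k) = late_edges 1 k \<and>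
    right_pairs (Phi_suffix n \<tau> k) = late_edges 2 k"
  using assms
proof (induction k rule: inc_induct)
  case base
  have "\<not> 2 * n + 1 \<le> \<tau> (r, 1)" "\<not> 2 * n + 1 \<le> \<tau> (r, 2)" "\<tau> (r, 2) \<noteq> 2 * n + 1"
    if "r \<in> {1..n}" for r
    using SPCT_range[OF that, of 1] SPCT_range[OF that, of 2] by auto
  then show ?case
    unfolding Phi_suffix_end by (auto simp: late_edges_def time_edges_def)
next
  case (step k)
  let ?S = "Phi_suffix n \<tau> (Suc k)"
  have v: "valid ?S"
    and D: "set (down_labels ?S) = {r\<in>{1..n}. Suc k \<le> \<tau> (r, 1)}"
    and U: "set (up_labels ?S) = {r\<in>{1..n}. Suc k \<le> \<tau> (r, 2)}"
    and H: "\<And>r. r \<in> {1..n} \<Longrightarrow> \<tau> (r, 2) = Suc k \<Longrightarrow> hd (up_labels ?S) = r"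
    and R: "\<And>r. r \<in> {1..n} \<Longrightarrow> Suc k \<le> 2 * n \<Longrightarrow> \<tau> (r, 1) = 2 * n \<Longrightarrow> last (down_labels ?S) = r"
    and LP: "left_pairs ?S = late_edges 1 (Suc k)"
    and RP: "right_pairs ?S = late_edges 2 (Suc k)"
    using step.IH by auto
  obtain r c where r: "r \<in> {1..n}" and c: "c \<in> {1, 2}" and rk: "\<tau> (r, c) = k"
    using SPCT_surj[of k] step by auto
  have ge: "{s\<in>{1..n}. k \<le> \<tau> (s, d)} =
      (if c = d then insert r {s\<in>{1..n}. Suc k \<le> \<tau> (s, d)} else {s\<in>{1..n}. Suc k \<le> \<tau> (s, d)})"
    if "d \<in> {1, 2}" for d
  proof -
    have "k \<le> \<tau> (s, d) \<longleftrightarrow> Suc k \<le> \<tau> (s, d) \<or> (s = r \<and> c = d)" if "s \<in> {1..n}" for s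
      using SPCT_inj[OF that r \<open>d \<in> {1, 2}\<close> c] rk by auto
    then show ?thesis using r by auto
  qed
  have one_two: "(1::nat) \<in> {1, 2}" "(2::nat) \<in> {1, 2}" "(1::nat) \<noteq> 2" by auto
  show ?case
  proof (cases "c = 1")
    case True
    then have rk: "\<tau> (r, 1) = k" using rk by simp
    have S: "Phi_suffix n \<tau> k = Down r # ?S" by (rule Phi_suffix_down[OF r rk])
    have no_up: "\<tau> (s, 2) \<noteq> k" if "s \<in> {1..n}" for s
      using SPCT_inj[of s r 2 1] that r rk by auto
    have "last (down_labels (Phi_suffix n \<tau> k)) = s" if "s \<in> {1..n}" "\<tau> (s, 1) = 2 * n" for s
    proof (cases "k = 2 * n")
      case True
      then have "s = r" using SPCT_inj[of s r 1 1] that r rk by auto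
      then show ?thesis using True Phi_suffix_end unfolding S by simp
    next
      case False
      then have "Suc k \<le> 2 * n" using step(2) by simp
      \<comment> \<open>The later part already contains the down-step \<open>s\<close>, so a new
        first label leaves \<open>last\<close> unchanged.\<close>
      moreover from this have "s \<in> set (down_labels ?S)" using D that by simp
      ultimately show ?thesis using R[OF that(1) _ that(2)] unfolding S by auto
    qed
    moreover have "left_pairs (Phi_suffix n \<tau> k) = late_edges 1 k \<and>
        right_pairs (Phi_suffix n \<tau> k) = late_edges 2 k"
    proof (cases "k = 2 * n")
      case True
      have "\<tau> (s, d) \<noteq> Suc k" if "s \<in> {1..n}" "d \<in> {1, 2}" for s d
        using SPCT_range[OF that] True by auto
      then show ?thesis
        using LP RP True Phi_suffix_end unfolding S late_edges_down[OF r rk] by auto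
    next
      case False
      then have "Suc k \<in> {1..2 * n}" using step(2) by simp
      \<comment> \<open>The cell of \<open>Suc k\<close> is the step right after the new down-step.
        Its column decides whether a left or a right pair arises, and its row is the parent.\<close>
      then obtain s d where s: "s \<in> {1..n}" and d: "d \<in> {1, 2}" and sk: "\<tau> (s, d) = Suc k"
        by (rule SPCT_surj)
      have uniq: "{(s', r) | s'. s' \<in> {1..n} \<and> \<tau> (s', e) = Suc k} =
          (if e = d then {(s, r)} else {})" if "e \<in> {1, 2}" for e
      proof -
        have "s' = s \<and> e = d" if "s' \<in> {1..n}" "\<tau> (s', e) = Suc k" for s'
          using SPCT_inj[OF that(1) s \<open>e \<in> {1, 2}\<close> d] that(2) sk by simp
        then have "s' \<in> {1..n} \<and> \<tau> (s', e) = Suc k \<longleftrightarrow> s' = s \<and> e = d" for s'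
          using s sk by meson
        then show ?thesis by (simp only:) auto
      qed
      show ?thesis
      proof (cases "d = 1")
        case True
        then have "?S = Down s # Phi_suffix n \<tau> (Suc (Suc k))"
          using Phi_suffix_down[OF s] sk by simp
        then have "left_pairs (Phi_suffix n \<tau> k) = insert (s, r) (left_pairs ?S)"
          "right_pairs (Phi_suffix n \<tau> k) = right_pairs ?S"
          unfolding S by simp_all
        then show ?thesis
          unfolding late_edges_down[OF r rk] LP RP uniq[OF one_two(1)] uniq[OF one_two(2)]
          using True by simp
      next
        case False
        then have d2: "d = 2" using d by simp
        then have S2: "?S = Up # Phi_suffix n \<tau> (Suc (Suc k))"
          using Phi_suffix_up[OF s] sk by simp
        have "hd (up_labels ?S) = s" using H[OF s] sk d2 by simp
        then have "right_pairs (Phi_suffix n \<tau> k) = insert (s, r) (right_pairs ?S)"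
          "left_pairs (Phi_suffix n \<tau> k) = left_pairs ?S"
          unfolding S S2 by simp_all
        then show ?thesis
          unfolding late_edges_down[OF r rk] LP RP uniq[OF one_two(1)] uniq[OF one_two(2)]
          using d2 by simp
      qed
    qed
    moreover have "r \<notin> set (down_labels ?S)" using D rk by simp
    ultimately show ?thesis
      using v D U no_up ge[OF one_two(1)] ge[OF one_two(2)] True unfolding S by auto
  next
    case False
    then have c2: "c = 2" using c by simp
    then have rk: "\<tau> (r, 2) = k" using rk by simp
    have S: "Phi_suffix n \<tau> k = Up # ?S" by (rule Phi_suffix_up[OF r rk])
    let ?A = "set (down_labels ?S) - set (up_labels ?S)"
    \<comment> \<open>Row \<open>r\<close> itself is open at \<open>k\<close> because its first
      entry exceeds \<open>k\<close>; this also gives the nonemptiness required by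
      \<open>valid\<close>.\<close>
    have rA: "r \<in> ?A" using D U r rk SPCT_row[OF r] by auto
    have "r \<le> i" if "i \<in> ?A" for i
      using that SPCT_Min[OF r, of i] D U rk by auto
    then have Min: "Min ?A = r" using rA by (intro Min_eqI) auto
    have uniq: "s = r" if "s \<in> {1..n}" "\<tau> (s, 2) = k" for s
      using SPCT_inj[of s r 2 2] that r rk by auto
    have "k < 2 * n" using SPCT_row[OF r] SPCT_range[OF r one_two(1)] rk by simp
    then have "last (down_labels ?S) = s" if "s \<in> {1..n}" "\<tau> (s, 1) = 2 * n" for s
      using R[OF that(1) _ that(2)] by simp
    then show ?thesis
      using v D U uniq rA Min ge[OF one_two(1)] ge[OF one_two(2)] c2 LP RP
        late_edges_up[OF r rk]
      unfolding S by auto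
  qed
qed

text \<open>The case \<open>k = 1\<close> of the suffix description: all entries are at least 1, so
  no label or edge is cut off.\<close>

lemma Lambda_Phi:
  defines "T \<equiv> Lambda (Phi n \<tau>)"
  shows "T \<in> LTree n"
    and "c \<in> {1, 2} \<Longrightarrow> edges T c = time_edges n \<tau> c"
    and "r \<in> {1..n} \<Longrightarrow> \<tau> (r, 1) = 2 * n \<Longrightarrow> root_list T = [r]"
proof -
  let ?S = "Phi_suffix n \<tau> 1"
  have ge1: "Suc 0 \<le> \<tau> (r, 1)" if "r \<in> {1..n}" for r
    using SPCT_range[OF that, of 1] by auto
  have late: "late_edges c 1 = time_edges n \<tau> c" for c
    using ge1 by (auto simp: late_edges_def time_edges_def)
  have S: "valid ?S" "set (down_labels ?S) = {1..n}"
    "\<And>r. r \<in> {1..n} \<Longrightarrow> \<tau> (r, 1) = 2 * n \<Longrightarrow> last (down_labels ?S) = r"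
    "left_pairs ?S = time_edges n \<tau> 1" "right_pairs ?S = time_edges n \<tau> 2"
    using Phi_suffix_props[of 1] ge1 unfolding late by auto
  note L = Lambda_props[OF S(1), unfolded Phi_suffix_1, folded T_def]
  note S = S[unfolded Phi_suffix_1]
  have d: "distinct (inorder T)"
    using L valid_distinct[OF S(1)] mset_eq_imp_distinct_iff by blast
  have t: "set_tree T = {1..n}"
    using L S(2) by (metis set_inorder set_mset_mset)
  have "size T = n" using distinct_card[OF d] t by simp
  with d t show "T \<in> LTree n" by (simp add: LTree_def)
  show "c \<in> {1, 2} \<Longrightarrow> edges T c = time_edges n \<tau> c"
    using L S by (auto simp: edges_def)
  show "root_list T = [r]" if r: "r \<in> {1..n}" "\<tau> (r, 1) = 2 * n"
    using L S(2) S(3)[OF r] r by auto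
qed

lemma SPCT_root:
  assumes "n \<ge> 1"
  obtains r where "r \<in> {1..n}" "\<tau> (r, 1) = 2 * n"
proof -
  have "2 * n \<in> {1..2 * n}" using assms by simp
  then obtain r c where r: "r \<in> {1..n}" "c \<in> {1, 2}" "\<tau> (r, c) = 2 * n" by (rule SPCT_surj)
  \<comment> \<open>A second-column entry has a larger entry in its row, so it cannot be the
    maximum.\<close>
  moreover have "c \<noteq> 2" using SPCT_row[OF r(1)] SPCT_range[OF r(1), of 1] r(3) by auto
  ultimately show thesis using that by auto
qed

section \<open>Descents counted by edges\<close>

text \<open>An edge \<open>(s, r)\<close> corresponds to the descent \<open>\<tau> (r, 1)\<close>:
  this entry determines \<open>r\<close>, and its successor determines \<open>s\<close>.\<close>

lemma card_descents:
  assumes "c \<in> {1, 2}"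
  shows "card {i. \<exists>r\<in>{1..n}. \<exists>s\<in>{1..n}. \<tau> (r, 1) = i \<and> \<tau> (s, c) = i + 1 \<and> P s r} =
    card {(s, r). (s, r) \<in> time_edges n \<tau> c \<and> P s r}"
proof -
  let ?A = "{(s, r). (s, r) \<in> time_edges n \<tau> c \<and> P s r}"
  have "inj_on (\<lambda>(s, r). \<tau> (r, 1)) ?A"
  proof (rule inj_onI, clarify)
    fix s r s' r'
    assume *: "(s, r) \<in> time_edges n \<tau> c" "(s', r') \<in> time_edges n \<tau> c" "\<tau> (r, 1) = \<tau> (r', 1)"
    then show "s = s' \<and> r = r'"
      using SPCT_inj[of r r' 1 1] SPCT_inj[of s s' c c] assms by (auto simp: time_edges_def)
  qed
  moreover have "{i. \<exists>r\<in>{1..n}. \<exists>s\<in>{1..n}. \<tau> (r, 1) = i \<and> \<tau> (s, c) = i + 1 \<and> P s r} =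
      (\<lambda>(s, r). \<tau> (r, 1)) ` ?A"
    by (force simp: time_edges_def)
  ultimately show ?thesis by (simp add: card_image)
qed

text \<open>Turns the negated comparison in \<open>ldes\<close> and \<open>rdes\<close> into the
  strict one of the tableau descents. In column 2 such a loop would make the row increase.\<close>

lemma time_edges_irrefl: "c \<in> {1, 2} \<Longrightarrow> (r, r) \<notin> time_edges n \<tau> c"
  using SPCT_row[of r] by (auto simp: time_edges_def)

end

lemma length_filter_edges:
  assumes "distinct (inorder T)"
  shows "length (filter (\<lambda>(p, q). P p q) (left_edges T)) = card {(p, q). (p, q) \<in> edges T 1 \<and> P p q}"
    and "length (filter (\<lambda>(p, q). P p q) (right_edges T)) = card {(p, q). (p, q) \<in> edges T 2 \<and> P p q}"
proof -
  have "length (filter (\<lambda>(p, q). P p q) xs) = card {(p, q). (p, q) \<in> set xs \<and> P p q}"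
    if "distinct xs" for xs :: "('a \<times> 'a) list"
  proof -
    have "length (filter (\<lambda>(p, q). P p q) xs) = card (set (filter (\<lambda>(p, q). P p q) xs))"
      by (rule distinct_card[symmetric]) (use that in simp)
    also have "set (filter (\<lambda>(p, q). P p q) xs) = {(p, q). (p, q) \<in> set xs \<and> P p q}" by auto
    finally show ?thesis .
  qed
  moreover have "distinct (left_edges T)" "distinct (right_edges T)"
    using distinct_fst_edges[OF assms] by (simp_all add: distinct_map)
  ultimately show
    "length (filter (\<lambda>(p, q). P p q) (left_edges T)) = card {(p, q). (p, q) \<in> edges T 1 \<and> P p q}"
    "length (filter (\<lambda>(p, q). P p q) (right_edges T)) = card {(p, q). (p, q) \<in> edges T 2 \<and> P p q}"
    by (simp_all add: edges_def)
qed

lemma descent_statistics: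
  assumes "\<tau> \<in> SPCT n"
  defines "T \<equiv> Lambda (Phi n \<tau>)"
  shows "card (des_N n \<tau>) = lasc T" "card (des_S n \<tau>) = ldes T"
    "card (des_NE n \<tau>) = rasc T" "card (des_SE n \<tau>) = rdes T"
proof -
  have d: "distinct (inorder T)"
    using Lambda_Phi(1)[OF assms(1)] by (simp add: T_def LTree_def)
  have e: "edges T c = time_edges n \<tau> c" if "c \<in> {1, 2}" for c
    unfolding T_def by (rule Lambda_Phi(2)[OF assms(1) that])
  have gt: "{(s, r). (s, r) \<in> time_edges n \<tau> c \<and> r < s} = {(s, r). (s, r) \<in> time_edges n \<tau> c \<and> \<not> s < r}"
    if "c \<in> {1, 2}" for c
    using time_edges_irrefl[OF assms(1) that] by (auto simp: not_less le_less)
  have 1: "(1::nat) \<in> {1, 2}" "(2::nat) \<in> {1, 2}" by auto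
  note simps = length_filter_edges[OF d] e[OF 1(1)] e[OF 1(2)]
    card_descents[OF assms(1) 1(1)] card_descents[OF assms(1) 1(2)]
  show "card (des_N n \<tau>) = lasc T" unfolding des_N_def lasc_def simps ..
  show "card (des_S n \<tau>) = ldes T" unfolding des_S_def ldes_def simps gt[OF 1(1)] ..
  show "card (des_NE n \<tau>) = rasc T" unfolding des_NE_def rasc_def simps ..
  show "card (des_SE n \<tau>) = rdes T" unfolding des_SE_def rdes_def simps gt[OF 1(2)] ..
qed


section \<open>Injectivity\<close>

lemma SPCT_eq_if_edges_eq:
  assumes "n \<ge> 1" and \<tau>: "\<tau> \<in> SPCT n" and \<sigma>: "\<sigma> \<in> SPCT n"
    and edges: "\<And>c. c \<in> {1, 2} \<Longrightarrow> time_edges n \<tau> c = time_edges n \<sigma> c"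
    and root: "\<And>r. r \<in> {1..n} \<Longrightarrow> \<tau> (r, 1) = 2 * n \<longleftrightarrow> \<sigma> (r, 1) = 2 * n"
  shows "\<tau> = \<sigma>"
proof -
  have one_two: "(1::nat) \<in> {1, 2}" "(2::nat) \<in> {1, 2}" by auto
  \<comment> \<open>Descending induction on \<open>k\<close>: the entries from \<open>k\<close> to
    \<open>2 * n\<close> occupy the same cells in both tableaux.\<close>
  have agree: "\<forall>j\<in>{k..2 * n}. \<forall>r\<in>{1..n}. \<forall>c\<in>{1, 2}. \<tau> (r, c) = j \<longleftrightarrow> \<sigma> (r, c) = j"
    if "1 \<le> k" "k \<le> 2 * n + 1" for k
    using that(2,1)
  proof (induction k rule: inc_induct)
    case base
    then show ?case by simp
  next
    case (step k)
    have IH: "\<tau> (r, c) = j \<longleftrightarrow> \<sigma> (r, c) = j"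
      if "Suc k \<le> j" "j \<le> 2 * n" "r \<in> {1..n}" "c \<in> {1, 2}" for j r c
    proof -
      have "j \<in> {Suc k..2 * n}" using that by simp
      with step.IH that(3,4) show ?thesis by (metis One_nat_def Suc_le_eq zero_less_Suc)
    qed
    have k: "k \<in> {1..2 * n}" using step by simp
    obtain r c where r: "r \<in> {1..n}" and c: "c \<in> {1, 2}" and rk: "\<tau> (r, c) = k"
      using k by (rule SPCT_surj[OF \<tau>])
    obtain r' c' where r': "r' \<in> {1..n}" and c': "c' \<in> {1, 2}" and rk': "\<sigma> (r', c') = k"
      using k by (rule SPCT_surj[OF \<sigma>])
    \<comment> \<open>Entries above \<open>k\<close> already agree, so both tableaux have the same
      cells with entries larger than \<open>k\<close>.\<close>
    have gt_iff: "k < \<tau> (i, d) \<longleftrightarrow> k < \<sigma> (i, d)" if "i \<in> {1..n}" "d \<in> {1, 2}" for i d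
      using IH[of "\<tau> (i, d)", OF _ _ that] IH[of "\<sigma> (i, d)", OF _ _ that]
        SPCT_range[OF \<tau> that] SPCT_range[OF \<sigma> that] by (auto simp: Suc_le_eq)
    have "r = r' \<and> c = c'"
    proof (cases "k = 2 * n")
      case True
      have "c = 1" using SPCT_row[OF \<tau> r] SPCT_range[OF \<tau> r one_two(1)] c rk True by auto
      moreover from this have "\<sigma> (r, 1) = k" using root[OF r] rk True by simp
      ultimately show ?thesis using SPCT_inj[OF \<sigma> r r' one_two(1) c'] rk' by auto
    next
      case False
      then have "Suc k \<in> {1..2 * n}" using k by simp
      then obtain s d where s: "s \<in> {1..n}" and d: "d \<in> {1, 2}" and sk: "\<tau> (s, d) = Suc k"
        by (rule SPCT_surj[OF \<tau>])
      have sk': "\<sigma> (s, d) = Suc k" using IH[of "Suc k", OF _ _ s d] sk False k by simp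
      \<comment> \<open>\<open>Suc k\<close> is in cell \<open>(s, d)\<close> of both tableaux, so
        \<open>k\<close> being in cell \<open>(i, 1)\<close> means exactly that
        \<open>(s, i)\<close> is an edge in column \<open>d\<close>.\<close>
      have down_iff: "\<tau> (i, 1) = k \<longleftrightarrow> \<sigma> (i, 1) = k" if "i \<in> {1..n}" for i
      proof -
        have "(s, i) \<in> time_edges n \<tau> d \<longleftrightarrow> (s, i) \<in> time_edges n \<sigma> d"
          using edges[OF d] by simp
        then show ?thesis using s that sk sk' by (auto simp: time_edges_def)
      qed
      show ?thesis
      proof (cases "c = 1")
        case True
        then have "\<sigma> (r, 1) = k" using rk down_iff[OF r] by simp
        then show ?thesis using SPCT_inj[OF \<sigma> r r' one_two(1) c'] rk' True by auto
      next
        case False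
        then have c2: "c = 2" using c by simp
        have "c' \<noteq> 1"
        proof
          assume "c' = 1"
          then have "\<tau> (r', 1) = k" using rk' down_iff[OF r'] by simp
          then show False using SPCT_inj[OF \<tau> r r' c one_two(1)] rk c2 by simp
        qed
        then have c2': "c' = 2" using c' by simp
        have t: "\<tau> (r, 2) = k" and t': "\<sigma> (r', 2) = k" using rk rk' c2 c2' by simp_all
        \<comment> \<open>Each of the two rows is open at \<open>k\<close> in the other tableau as
          well, and minimality applies in both directions.\<close>
        have "r \<le> r'"
          using SPCT_Min[OF \<tau> r r'] gt_iff[OF r' one_two(1)] gt_iff[OF r' one_two(2)]
            SPCT_row[OF \<sigma> r'] unfolding t t' by auto
        moreover have "r' \<le> r"
          using SPCT_Min[OF \<sigma> r' r] gt_iff[OF r one_two(1)] gt_iff[OF r one_two(2)]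
            SPCT_row[OF \<tau> r] unfolding t t' by auto
        ultimately show ?thesis using c2 c2' by simp
      qed
    qed
    then have "\<tau> (i, e) = k \<longleftrightarrow> \<sigma> (i, e) = k" if "i \<in> {1..n}" "e \<in> {1, 2}" for i e
      using SPCT_inj[OF \<tau> that(1) r that(2) c] SPCT_inj[OF \<sigma> that(1) r that(2) c] rk rk' by auto
    then show ?case using IH by (metis atLeastAtMost_iff le_neq_implies_less Suc_leI)
  qed
  have "\<tau> x = \<sigma> x" if "x \<in> cells n" for x
  proof -
    from that obtain r c where x: "x = (r, c)" "r \<in> {1..n}" "c \<in> {1, 2}"
      by (auto simp: cells_def)
    then show ?thesis using agree[of 1, rule_format, OF _ _ SPCT_range[OF \<tau> x(2,3)] x(2,3)] by simp
  qed
  moreover have "\<tau> \<in> extensional (cells n)" "\<sigma> \<in> extensional (cells n)"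
    using \<tau> \<sigma> by (simp_all add: SPCT_def)
  ultimately show ?thesis by (rule extensionalityI[rotated 2])
qed

lemma inj_on_Lambda_Phi:
  assumes "n \<ge> 1"
  shows "inj_on (Lambda \<circ> Phi n) (SPCT n)"
proof (rule inj_onI)
  fix \<tau> \<sigma>
  assume \<tau>: "\<tau> \<in> SPCT n" and \<sigma>: "\<sigma> \<in> SPCT n"
    and "(Lambda \<circ> Phi n) \<tau> = (Lambda \<circ> Phi n) \<sigma>"
  then have eq: "Lambda (Phi n \<tau>) = Lambda (Phi n \<sigma>)" by simp
  obtain r where r: "r \<in> {1..n}" "\<tau> (r, 1) = 2 * n" by (rule SPCT_root[OF \<tau> assms])
  obtain s where s: "s \<in> {1..n}" "\<sigma> (s, 1) = 2 * n" by (rule SPCT_root[OF \<sigma> assms])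
  have "r = s" using Lambda_Phi(3)[OF \<tau> r] Lambda_Phi(3)[OF \<sigma> s] eq by simp
  show "\<tau> = \<sigma>"
  proof (rule SPCT_eq_if_edges_eq[OF assms \<tau> \<sigma>])
    show "time_edges n \<tau> c = time_edges n \<sigma> c" if "c \<in> {1, 2}" for c
      using Lambda_Phi(2)[OF \<tau> that] Lambda_Phi(2)[OF \<sigma> that] eq by simp
    show "\<tau> (i, 1) = 2 * n \<longleftrightarrow> \<sigma> (i, 1) = 2 * n" if "i \<in> {1..n}" for i
      using SPCT_inj[OF \<tau> that r(1), of 1 1] SPCT_inj[OF \<sigma> that s(1), of 1 1] r s \<open>r = s\<close> by auto
  qed
qed


section \<open>Surjectivity\<close>

text \<open>If \<open>cs\<close> holds the cells of the entries above \<open>k\<close>, these are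
  the rows open at \<open>k\<close>, the candidates for a second-column entry.\<close>

definition open_rows :: "(nat \<times> nat) list \<Rightarrow> nat set" where
  "open_rows cs = {r. (r, 1) \<in> set cs \<and> (r, 2) \<notin> set cs}"

text \<open>The head of the list is the cell of the smallest entry placed so far, its last element the
  cell of the largest entry \<open>2 * n\<close>.\<close>

inductive traversal :: "nat tree \<Rightarrow> (nat \<times> nat) list \<Rightarrow> bool" for T where
  root: "root_list T = [a] \<Longrightarrow> traversal T [(a, 1)]"
| down: "traversal T ((s, c) # cs) \<Longrightarrow> (s, q) \<in> edges T c \<Longrightarrow> traversal T ((q, 1) # (s, c) # cs)"
| up: "traversal T ((s, c) # cs) \<Longrightarrow> (\<And>q. (s, q) \<notin> edges T c) \<Longrightarrow>
    open_rows ((s, c) # cs) \<noteq> {} \<Longrightarrow>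
    traversal T ((Min (open_rows ((s, c) # cs)), 2) # (s, c) # cs)"

lemma open_rowsD:
  assumes "r \<in> open_rows cs"
  shows "(r, 1) \<in> set cs" "(r, 2) \<notin> set cs"
  using assms by (simp_all add: open_rows_def)

lemma finite_open_rows: "finite (open_rows cs)"
proof (rule finite_subset)
  show "open_rows cs \<subseteq> fst ` set cs" by (force simp: open_rows_def)
qed simp

lemma traversal_suffix: "traversal T (x # S) \<Longrightarrow> S \<noteq> [] \<Longrightarrow> traversal T S"
  by (erule traversal.cases) auto

text \<open>Every cell was the head at the moment it was placed, so the rules can be inverted at any
  position.\<close>

lemma traversal_drop: "traversal T cs \<Longrightarrow> i < length cs \<Longrightarrow> traversal T (drop i cs)"
proof (induction i)
  case (Suc i)
  have "traversal T (cs ! i # drop (Suc i) cs)"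
    using Suc.IH Suc.prems Cons_nth_drop_Suc[of i cs] by simp
  then show ?case by (rule traversal_suffix) (use Suc.prems in simp)
qed simp

lemma traversal_downD: "traversal T ((q, 1) # (s, c) # cs) \<Longrightarrow> (s, q) \<in> edges T c"
  by (erule traversal.cases) auto

lemma traversal_upD:
  "traversal T ((r, 2) # cs) \<Longrightarrow> r = Min (open_rows cs) \<and> open_rows cs \<noteq> {}"
  by (erule traversal.cases) auto

lemma traversal_last: "traversal T cs \<Longrightarrow> cs \<noteq> [] \<and> (\<exists>a. root_list T = [a] \<and> last cs = (a, 1))"
  by (induction rule: traversal.induct) auto

text \<open>The edge leaving the head may not have been followed yet, hence \<open>tl cs\<close> in
  the last two clauses. The clause on the origin of first-column cells is what yields
  distinctness.\<close>

lemma traversal_invariant: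
  assumes "traversal T cs" "distinct (inorder T)"
  shows "distinct cs \<and> set cs \<subseteq> set_tree T \<times> {1, 2} \<and>
    (\<forall>r. (r, 2) \<in> set cs \<longrightarrow> (r, 1) \<in> set cs) \<and>
    (\<forall>q. (q, 1) \<in> set cs \<longrightarrow> q \<in> set (root_list T) \<or>
       (\<exists>s c. c \<in> {1, 2} \<and> (s, q) \<in> edges T c \<and> (s, c) \<in> set (tl cs))) \<and>
    (\<forall>s c q. (s, c) \<in> set (tl cs) \<longrightarrow> (s, q) \<in> edges T c \<longrightarrow> (q, 1) \<in> set cs)"
  using assms(1)
proof (induction rule: traversal.induct)
  case (root a)
  then show ?case using root_list_subset[of T] by auto
next
  case (down s c cs q)
  have d: "distinct ((s, c) # cs)" and sub: "set ((s, c) # cs) \<subseteq> set_tree T \<times> {1, 2}"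
    using down.IH by blast+
  have c: "c \<in> {1, 2}" using sub by auto
  have q: "q \<in> set_tree T" using edges_subset[of T c] down.hyps(2) by auto
  \<comment> \<open>A previous visit to \<open>q\<close> would need \<open>q\<close> to be the root,
    which has no parent, or a previous use of the unique edge into \<open>q\<close>. The latter
    leaves cell \<open>(s, c)\<close>, which would then occur twice.\<close>
  have new: "(q, 1) \<notin> set ((s, c) # cs)"
  proof
    assume "(q, 1) \<in> set ((s, c) # cs)"
    then have "q \<in> set (root_list T) \<or> (\<exists>s' c'. c' \<in> {1, 2} \<and> (s', q) \<in> edges T c' \<and> (s', c') \<in> set cs)"
      using down.IH by auto
    then show False
    proof
      assume "q \<in> set (root_list T)"
      then show False using root_no_parent[OF assms(2)] down.hyps(2) by blast
    next
      assume "\<exists>s' c'. c' \<in> {1, 2} \<and> (s', q) \<in> edges T c' \<and> (s', c') \<in> set cs"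
      then obtain s' c' where *: "c' \<in> {1, 2}" "(s', q) \<in> edges T c'" "(s', c') \<in> set cs" by blast
      have "s = s'" "c = c'"
        using edges_unique_parent[OF assms(2) down.hyps(2) *(2) c *(1)] by auto
      then show False using *(3) d by simp
    qed
  qed
  have "(q', 1) \<in> set ((q, 1) # (s, c) # cs)"
    if "(s', c') \<in> set ((s, c) # cs)" "(s', q') \<in> edges T c'" for s' c' q'
  proof (cases "(s', c') = (s, c)")
    case True
    then have "q' = q" using edges_unique_child[OF assms(2)] down.hyps(2) that(2) by blast
    then show ?thesis by simp
  next
    case False
    then have "(s', c') \<in> set (tl ((s, c) # cs))" using that(1) by auto
    then have "(q', 1) \<in> set ((s, c) # cs)" using down.IH that(2) by blast
    then show ?thesis by simp
  qed
  moreover have "q' \<in> set (root_list T) \<or>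
      (\<exists>s' c'. c' \<in> {1, 2} \<and> (s', q') \<in> edges T c' \<and> (s', c') \<in> set ((s, c) # cs))"
    if "(q', 1) \<in> set ((q, 1) # (s, c) # cs)" for q'
  proof (cases "q' = q")
    case True
    then show ?thesis using down.hyps(2) c by auto
  next
    case False
    then have "(q', 1) \<in> set ((s, c) # cs)" using that by simp
    moreover have "set (tl ((s, c) # cs)) \<subseteq> set ((s, c) # cs)" by auto
    ultimately show ?thesis using down.IH by blast
  qed
  moreover have "\<forall>r. (r, 2) \<in> set ((s, c) # cs) \<longrightarrow> (r, 1) \<in> set ((s, c) # cs)"
    using down.IH by blast
  ultimately show ?case using d sub q new by simp
next
  case (up s c cs)
  let ?S = "(s, c) # cs"
  define m where "m = Min (open_rows ?S)"
  have "m \<in> open_rows ?S" unfolding m_def using up.hyps(3) by (intro Min_in finite_open_rows)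
  then have r: "(m, 1) \<in> set ?S" "(m, 2) \<notin> set ?S" by (rule open_rowsD)+
  have d: "distinct ?S" and sub: "set ?S \<subseteq> set_tree T \<times> {1, 2}" using up.IH by blast+
  have t: "m \<in> set_tree T" using r(1) sub by blast
  show ?case
    unfolding m_def[symmetric] list.sel
  proof (intro conjI allI impI)
    show "distinct ((m, 2) # ?S)" using d r(2) by simp
    show "set ((m, 2) # ?S) \<subseteq> set_tree T \<times> {1, 2}" using sub t by simp
    show "(q, 1) \<in> set ((m, 2) # ?S)" if "(q, 2) \<in> set ((m, 2) # ?S)" for q
    proof (cases "q = m")
      case True
      then show ?thesis using r(1) by simp
    next
      case False
      then have "(q, 2) \<in> set ?S" using that by simp
      then have "(q, 1) \<in> set ?S" using up.IH by blast
      then show ?thesis by simp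
    qed
    show "q \<in> set (root_list T) \<or>
        (\<exists>s' c'. c' \<in> {1, 2} \<and> (s', q) \<in> edges T c' \<and> (s', c') \<in> set ?S)"
      if "(q, 1) \<in> set ((m, 2) # ?S)" for q
    proof -
      have "(q, 1) \<in> set ?S" using that by simp
      moreover have "set (tl ?S) \<subseteq> set ?S" by auto
      ultimately show ?thesis using up.IH by blast
    qed
    show "(q, 1) \<in> set ((m, 2) # ?S)"
      if "(s', c') \<in> set ?S" "(s', q) \<in> edges T c'" for s' c' q
    proof -
      \<comment> \<open>The rule \<open>up\<close> applies only when no edge leaves the head, so
        moving the head into the tail creates no obligation.\<close>
      have "(s', c') \<noteq> (s, c)" using up.hyps(2) that(2) by auto
      then have "(s', c') \<in> set (tl ?S)" using that(1) by auto
      then have "(q, 1) \<in> set ?S" using up.IH that(2) by blast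
      then show ?thesis by simp
    qed
  qed
qed

text \<open>Traversals consist of distinct cells, so their lengths are bounded. A longest one admits
  neither rule: its head has no outgoing edge, and no row is open.\<close>

lemma traversal_complete:
  assumes "distinct (inorder T)" "T \<noteq> Leaf"
  obtains cs where "traversal T cs" "set cs = set_tree T \<times> {1, 2}"
proof -
  let ?P = "\<lambda>k. \<exists>cs. traversal T cs \<and> length cs = k"
  obtain a where a: "root_list T = [a]" using assms(2) by (cases T) (auto simp: root_list_def)
  have fin: "finite (set_tree T \<times> {1::nat, 2})" by simp
  have bound: "length cs \<le> card (set_tree T \<times> {1::nat, 2})" if "traversal T cs" for cs
    using traversal_invariant[OF that assms(1)] card_mono[OF fin] distinct_card by metis
  have "?P 1" using traversal.root[OF a] by force
  moreover have bound': "\<And>j. ?P j \<Longrightarrow> j \<le> card (set_tree T \<times> {1::nat, 2})" using bound by blast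
  ultimately obtain k where "?P k" and max: "\<And>j. ?P j \<Longrightarrow> j \<le> k"
    using GreatestI_nat[of ?P 1, OF _ bound'] Greatest_le_nat[of ?P, OF _ bound'] by blast
  then obtain cs where cs: "traversal T cs" "length cs = k" by blast
  note inv = traversal_invariant[OF cs(1) assms(1)]
  have stuck: "\<not> traversal T (x # cs)" for x
    using max[of "Suc k"] cs(2) by force
  obtain s c cs' where cs': "cs = (s, c) # cs'"
    using traversal_last[OF cs(1)] by (cases cs) auto
  have no_child: "(s, q) \<notin> edges T c" for q
    using stuck[of "(q, 1)"] cs(1) traversal.down unfolding cs' by blast
  then have "open_rows cs = {}"
    using stuck cs(1) traversal.up unfolding cs' by blast
  then have ups: "(r, 2) \<in> set cs" if "(r, 1) \<in> set cs" for r
    using that by (auto simp: open_rows_def)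
  \<comment> \<open>The head has no outgoing edge, so the invariant for the tail covers all
    cells.\<close>
  have closed: "(q, 1) \<in> set cs" if "(s', c') \<in> set cs" "(s', q) \<in> edges T c'" for s' c' q
  proof -
    have "(s', c') \<in> set (tl cs)" using that no_child by (auto simp: cs')
    then show ?thesis using inv that(2) by blast
  qed
  have "set_tree T \<subseteq> {r. (r, 1) \<in> set cs}"
  proof (rule set_tree_subset_closed)
    have "cs \<noteq> []" "last cs = (a, 1)" using traversal_last[OF cs(1)] a by auto
    then have "(a, 1) \<in> set cs" using last_in_set by metis
    then show "set (root_list T) \<subseteq> {r. (r, 1) \<in> set cs}" by (simp add: a)
    fix p q
    assume p: "p \<in> {r. (r, 1) \<in> set cs}" and "(p, q) \<in> set (left_edges T) \<union> set (right_edges T)"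
    then have "(p, q) \<in> edges T 1 \<or> (p, q) \<in> edges T 2" by (auto simp: edges_def)
    \<comment> \<open>With no open row, both cells of the visited node \<open>p\<close> are in the
      list, hence both its left and its right edge have been followed.\<close>
    then show "q \<in> {r. (r, 1) \<in> set cs}" using closed p ups by blast
  qed
  then have "set_tree T \<times> {1, 2} \<subseteq> set cs" using ups by auto
  then have "set cs = set_tree T \<times> {1, 2}" using inv by blast
  with cs(1) show thesis by (rule that)
qed

section \<open>The tableau of a complete traversal\<close>

lemma mem_set_drop_iff: "x \<in> set (drop k xs) \<longleftrightarrow> (\<exists>i\<ge>k. i < length xs \<and> xs ! i = x)"
proof
  assume "x \<in> set (drop k xs)"
  then obtain i where "i < length (drop k xs)" "drop k xs ! i = x" by (auto simp: in_set_conv_nth)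
  then show "\<exists>i\<ge>k. i < length xs \<and> xs ! i = x" by (intro exI[of _ "k + i"]) auto
next
  assume "\<exists>i\<ge>k. i < length xs \<and> xs ! i = x"
  then obtain i where "i \<ge> k" "i < length xs" "xs ! i = x" by blast
  then show "x \<in> set (drop k xs)" by (auto simp: in_set_conv_nth intro!: exI[of _ "i - k"])
qed

lemma surj_Lambda_Phi:
  assumes "n \<ge> 1" "T \<in> LTree n"
  obtains \<tau> where "\<tau> \<in> SPCT n" "Lambda (Phi n \<tau>) = T"
proof -
  have d: "distinct (inorder T)" and size: "size T = n" using assms(2) by (simp_all add: LTree_def)
  have "card (set_tree T) = n" using distinct_card[OF d] size by simp
  then have t: "set_tree T = {1..n}"
    using assms(2) by (intro card_subset_eq) (auto simp: LTree_def)
  have "T \<noteq> Leaf" using size assms(1) by auto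
  from traversal_complete[OF d this] obtain cs
    where cs: "traversal T cs" and "set cs = set_tree T \<times> {1, 2}" by blast
  then have set: "set cs = cells n" by (simp add: t cells_def)
  have dist: "distinct cs" using traversal_invariant[OF cs d] by blast
  have len: "length cs = 2 * n"
    using distinct_card[OF dist] by (simp add: set cells_def card_cartesian_product)
  define pos where "pos = inv_into {..<2 * n} ((!) cs)"
  have bij: "bij_betw ((!) cs) {..<2 * n} (cells n)"
    by (rule bij_betw_nth) (simp_all add: dist len set)
  have bij_pos: "bij_betw pos (cells n) {..<2 * n}"
    unfolding pos_def by (rule bij_betw_inv_into[OF bij])
  have pos: "pos x < 2 * n" "cs ! pos x = x" if "x \<in> cells n" for x
    using bij_betwE[OF bij_pos] that bij_betw_inv_into_right[OF bij that] by (auto simp: pos_def)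
  have pos_nth: "pos (cs ! i) = i" if "i < 2 * n" for i
    using bij_betw_inv_into_left[OF bij] that by (simp add: pos_def)
  \<comment> \<open>Positions count from 0 and entries from 1, hence \<open>Suc\<close>; the value
    \<open>undefined\<close> outside the cells makes the filling extensional.\<close>
  define \<tau> where "\<tau> x = (if x \<in> cells n then Suc (pos x) else undefined)" for x
  have cell: "(r, 1) \<in> cells n" "(r, 2) \<in> cells n" if "r \<in> {1..n}" for r
    using that by (auto simp: cells_def)
  have drop_iff: "x \<in> set (drop k cs) \<longleftrightarrow> k \<le> pos x" if "x \<in> cells n" for x k
    unfolding mem_set_drop_iff using pos[OF that] pos_nth len by auto
  have trav: "traversal T (x # drop (Suc (pos x)) cs)" if "x \<in> cells n" for x
  proof -
    have "drop (pos x) cs = x # drop (Suc (pos x)) cs"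
      using pos[OF that] len by (metis Cons_nth_drop_Suc)
    then show ?thesis using traversal_drop[OF cs, of "pos x"] pos(1)[OF that] len by simp
  qed
  \<comment> \<open>Inverting the rule \<open>up\<close> at the moment when \<open>(r, 2)\<close>
    was placed: \<open>r\<close> was the least open row.\<close>
  have up_min: "r \<in> open_rows (drop (Suc (pos (r, 2))) cs)"
    "\<And>i. i \<in> open_rows (drop (Suc (pos (r, 2))) cs) \<Longrightarrow> r \<le> i" if "r \<in> {1..n}" for r
    using traversal_upD[OF trav[OF cell(2)[OF that]]] finite_open_rows Min_in Min_le
    by metis+
  have row: "pos (r, 2) < pos (r, 1)" if "r \<in> {1..n}" for r
    using up_min(1)[OF that] drop_iff[OF cell(1)[OF that]] by (simp add: open_rows_def Suc_le_eq)
  have triple: "pos (r, 2) < pos (i, 2)"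
    if "i \<in> {1..n}" "r \<in> {1..n}" "i < r" "pos (r, 2) \<le> pos (i, 1)" for i r
  proof (rule ccontr)
    assume "\<not> pos (r, 2) < pos (i, 2)"
    \<comment> \<open>Different cells have different positions, so the weak inequality of the triple
      condition becomes strict and row \<open>i\<close> would be open when \<open>(r, 2)\<close> is
      placed.\<close>
    moreover have "pos (r, 2) \<noteq> pos (i, 1)"
      using pos(2) cell that(1,2) by (metis prod.inject one_eq_numeral_iff num.distinct(1))
    ultimately have "i \<in> open_rows (drop (Suc (pos (r, 2))) cs)"
      using drop_iff[OF cell(1)[OF that(1)]] drop_iff[OF cell(2)[OF that(1)]] that(4)
      by (simp add: open_rows_def Suc_le_eq)
    then show False using up_min(2)[OF that(2)] that(3) by fastforce
  qed
  have "bij_betw (Suc \<circ> pos) (cells n) {1..2 * n}"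
    by (rule bij_betw_trans[OF bij_pos]) (simp add: bij_betw_def image_Suc_lessThan)
  then have "bij_betw \<tau> (cells n) {1..2 * n}"
    by (rule bij_betw_cong[THEN iffD1, rotated]) (simp add: \<tau>_def)
  then have \<tau>: "\<tau> \<in> SPCT n"
    using row triple cell by (auto simp: SPCT_def \<tau>_def extensional_def)
  let ?T = "Lambda (Phi n \<tau>)"
  \<comment> \<open>Consecutive entries are neighbours in \<open>cs\<close>, and a first-column cell
    in front of another cell can only come from the rule \<open>down\<close>.\<close>
  have "time_edges n \<tau> c \<subseteq> edges T c" if c: "c \<in> {1, 2}" for c
  proof clarify
    fix s r
    assume "(s, r) \<in> time_edges n \<tau> c"
    then have sr: "r \<in> {1..n}" "(s, c) \<in> cells n" "pos (s, c) = Suc (pos (r, 1))"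
      using c by (auto simp: time_edges_def \<tau>_def cells_def)
    have "drop (pos (s, c)) cs = (s, c) # drop (Suc (pos (s, c))) cs"
      using pos[OF sr(2)] len by (metis Cons_nth_drop_Suc)
    then have "traversal T ((r, 1) # (s, c) # drop (Suc (pos (s, c))) cs)"
      using trav[OF cell(1)[OF sr(1)]] sr(3) by simp
    then show "(s, r) \<in> edges T c" by (rule traversal_downD)
  qed
  then have sub: "edges ?T c \<subseteq> edges T c" if "c \<in> {1, 2}" for c
    using Lambda_Phi(2)[OF \<tau> that] that by simp
  obtain a where a: "root_list T = [a]" "last cs = (a, 1)" using traversal_last[OF cs] by blast
  have "a \<in> {1..n}" using root_list_subset[of T] a(1) t by simp
  \<comment> \<open>The root cell ends the list, at index \<open>2 * n - 1\<close>, so it receives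
    the entry \<open>2 * n\<close>.\<close>
  moreover have "cs ! (2 * n - 1) = (a, 1)"
    using a(2) len assms(1) by (metis last_conv_nth list.size(3) mult_eq_0_iff not_one_le_zero zero_neq_numeral)
  then have "pos (a, 1) = 2 * n - 1" using pos_nth[of "2 * n - 1"] assms(1) by simp
  then have "\<tau> (a, 1) = 2 * n" using cell(1)[OF \<open>a \<in> {1..n}\<close>] assms(1) by (simp add: \<tau>_def)
  ultimately have "root_list ?T = root_list T" using Lambda_Phi(3)[OF \<tau>, of a] a(1) by simp
  moreover have "size ?T = size T" using Lambda_Phi(1)[OF \<tau>] size by (simp add: LTree_def)
  ultimately have "?T = T"
    using tree_eq_if_edges_subset[OF d] sub by simp
  with \<tau> show thesis by (rule that)
qed

theorem theorem4p8:
  fixes n :: nat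
  assumes "n \<ge> 1"
  shows "bij_betw (Lambda \<circ> Phi n) (SPCT n) (LTree n) \<and>
    (\<forall>\<tau>\<in>SPCT n. let T = Lambda (Phi n \<tau>) in
       (card (des_N n \<tau>), card (des_S n \<tau>), card (des_NE n \<tau>), card (des_SE n \<tau>)) =
       (lasc T, ldes T, rasc T, rdes T))"
proof
  have "(Lambda \<circ> Phi n) ` SPCT n = LTree n"
  proof
    show "(Lambda \<circ> Phi n) ` SPCT n \<subseteq> LTree n" using Lambda_Phi(1) by auto
    show "LTree n \<subseteq> (Lambda \<circ> Phi n) ` SPCT n"
    proof
      fix T assume "T \<in> LTree n"
      from surj_Lambda_Phi[OF assms this] obtain \<tau> where "\<tau> \<in> SPCT n" "Lambda (Phi n \<tau>) = T" .
      then show "T \<in> (Lambda \<circ> Phi n) ` SPCT n" by force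
    qed
  qed
  with inj_on_Lambda_Phi[OF assms] show "bij_betw (Lambda \<circ> Phi n) (SPCT n) (LTree n)"
    by (simp add: bij_betw_def)
  show "\<forall>\<tau>\<in>SPCT n. let T = Lambda (Phi n \<tau>) in
       (card (des_N n \<tau>), card (des_S n \<tau>), card (des_NE n \<tau>), card (des_SE n \<tau>)) =
       (lasc T, ldes T, rasc T, rdes T)"
    using descent_statistics by (simp add: Let_def)
qed

end
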